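(* Let $\mathcal{A}\subset\mathbb{N}$ be an infinite set. There exists an increasing sequence of positive integers along which $\mathcal{A}$ has doubly metric Poissonian pair correlations if and only if $$\liminf_{N\to\infty}N^{-3}E(A_N)=0.$$
   Context: $\mathbb{N}=\{1,2,3,\dots\}$, $\mathbb{T}=\mathbb{R}/\mathbb{Z}$, $\|\cdot\|$ denotes distance to $0$ in $\mathbb{T}$, and $[N]=\{1,\dots,N\}$. For an infinite set $\mathcal{A}\subset\mathbb{N}$, enumerate its elements in increasing order as $a_1<a_2<\cdots$, and let $A_N=\{a_1,\dots,a_N\}$ be the set of its smallest $N$ elements. The additive energy of a finite set $A$ of integers is $$E(A)=\#\{(a,b,c,d)\in A^4 : a+b=c+d\}.$$ For $\alpha,\gamma\in\mathbb{T}$, $s>0$, $N\in\mathbb{N}$, define $$F(\alpha,\gamma,s,N,\mathcal{A})=\frac1N\#\Big\{(i,j)\in[N]\times[N] : i\neq j,\ \|a_i\alpha-a_j\alpha-\gamma\|\le \frac sN\Big\}.$$ For an increasing sequence $\{N_t\}\subset\mathbb{N}$, the set $\mathcal{A}$ has doubly metric Poissonian pair correlations along $\{N_t\}$ if for Lebesgue-almost every pair $(\alpha,\gamma)\in\mathbb{T}^2$ one has $\lim_{t\to\infty}F(\alpha,\gamma,s,N_t,\mathcal{A})=2s$ for every real $s>0$. *)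

theory Defs
  imports "HOL-Analysis.Analysis"
begin

text \<open>
  Elements of the torus \<open>\<real>/\<int>\<close> are given by real representatives. On these, the distance to \<open>0\<close>
  in \<open>\<real>/\<int>\<close> is the distance to the nearest integer.
\<close>

definition torus_norm :: "real \<Rightarrow> real" where
  "torus_norm x = infdist x \<int>"

text \<open>The library function \<^const>\<open>enumerate\<close> counts from \<open>0\<close>; here \<open>elt A 1\<close> is the least element.\<close>

definition elt :: "nat set \<Rightarrow> nat \<Rightarrow> nat" where
  "elt A i = enumerate A (i - 1)"

definition first_elts :: "nat set \<Rightarrow> nat \<Rightarrow> nat set" where
  "first_elts A N = elt A ` {1..N}"

definition additive_energy :: "'a::ab_semigroup_add set \<Rightarrow> nat" where
  "additive_energy A = card {(a, b, c, d). a \<in> A \<and> b \<in> A \<and> c \<in> A \<and> d \<in> A \<and> a + b = c + d}"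

definition pair_corr :: "real \<Rightarrow> real \<Rightarrow> real \<Rightarrow> nat \<Rightarrow> nat set \<Rightarrow> real" where
  "pair_corr \<alpha> \<gamma> s N A =
     (1 / real N) * real (card {(i, j) \<in> {1..N} \<times> {1..N}. i \<noteq> j \<and>
        torus_norm (real (elt A i) * \<alpha> - real (elt A j) * \<alpha> - \<gamma>) \<le> s / real N})"

lemma torus_norm_add_Ints:
  assumes "k \<in> \<int>"
  shows "torus_norm (x + k) = torus_norm x"
proof -
  have "(\<lambda>n. dist (x + k) n) ` \<int> = dist x ` \<int>"
  proof (intro equalityI subsetI)
    fix y assume "y \<in> (\<lambda>n. dist (x + k) n) ` \<int>"
    then obtain n where "n \<in> \<int>" "y = dist (x + k) n" by auto
    then show "y \<in> dist x ` \<int>"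
      using assms by (intro image_eqI[where x = "n - k"]) (auto simp: dist_real_def algebra_simps)
  next
    fix y assume "y \<in> dist x ` \<int>"
    then obtain n where "n \<in> \<int>" "y = dist x n" by auto
    then show "y \<in> (\<lambda>n. dist (x + k) n) ` \<int>"
      using assms by (intro image_eqI[where x = "n + k"]) (auto simp: dist_real_def algebra_simps)
  qed
  moreover have "(\<int> :: real set) \<noteq> {}" using Ints_0 by blast
  ultimately show ?thesis by (simp add: torus_norm_def infdist_def)
qed

lemma pair_corr_add_Ints:
  assumes "k \<in> \<int>" "l \<in> \<int>"
  shows "pair_corr (\<alpha> + k) (\<gamma> + l) s N A = pair_corr \<alpha> \<gamma> s N A"
proof -
  have "torus_norm (real m * (\<alpha> + k) - real n * (\<alpha> + k) - (\<gamma> + l)) =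
        torus_norm (real m * \<alpha> - real n * \<alpha> - \<gamma>)" for m n
    using torus_norm_add_Ints[of "real m * k - real n * k - l" "real m * \<alpha> - real n * \<alpha> - \<gamma>"] assms
    by (simp add: algebra_simps)
  then show ?thesis by (simp add: pair_corr_def)
qed

text \<open>
  By the periodicity just shown, \<open>\<alpha>\<close> and \<open>\<gamma>\<close> may be taken from the fundamental domain \<open>[0,1)\<close>,
  where Lebesgue measure represents the Haar measure of the torus.
\<close>

definition doubly_metric_poissonian_along :: "nat set \<Rightarrow> (nat \<Rightarrow> nat) \<Rightarrow> bool" where
  "doubly_metric_poissonian_along A N \<longleftrightarrow>
     (AE (\<alpha>, \<gamma>) in lebesgue_on ({0..<1} \<times> {0..<1}).
        \<forall>s>0. (\<lambda>t. pair_corr \<alpha> \<gamma> s (N t) A) \<longlonglongrightarrow> 2 * s)"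

end

theory Submission
  imports Defs "HOL-Probability.Probability_Measure"
begin

text \<open>
  For an integer \<open>d\<close>, let \<open>S\<^sub>d\<close> be the strip of all \<open>(\<alpha>, \<gamma>)\<close> with \<open>\<parallel>d \<alpha> - \<gamma>\<parallel> \<le> s / N\<close>. Any two of them are
  independent, since \<open>(\<alpha>, \<gamma>) \<mapsto> (d \<alpha> - \<gamma>, e \<alpha> - \<gamma>)\<close> preserves the measure of the torus for \<open>d \<noteq> e\<close>. If
  \<open>r(d)\<close> counts the representations of \<open>d\<close> as a difference of elements of \<open>A\<^sub>N\<close>, the pair correlation
  is \<open>1 / N\<close> times the sum over \<open>d \<noteq> 0\<close> of \<open>r(d)\<close> times the indicator of \<open>S\<^sub>d\<close>. Its variance is thus at
  most \<open>2 s / N\<^sup>3\<close> times the sum of \<open>r(d)\<^sup>2\<close>, hence at most \<open>2 s E(A\<^sub>N) / N\<^sup>3\<close>, and Chebyshev's inequality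
  and the Borel--Cantelli lemma give convergence along a sufficiently sparse sequence. Conversely, if
  \<open>E(A\<^sub>N) \<ge> c N\<^sup>3\<close>, then a number of differences proportional to \<open>N\<close> has \<open>r(d) \<ge> c N / 2\<close>. For small
  \<open>s\<close> the union of their strips has measure bounded away from \<open>0\<close>, while the pair correlation on it
  is at least \<open>c / 2 > 2 s\<close>.
\<close>

section \<open>Strips on the torus\<close>

lemma periodic_of_int:
  fixes g :: "real \<Rightarrow> 'a"
  assumes "\<And>x. g (x + 1) = g x"
  shows "g (x + of_int n) = g x"
proof (induction n rule: int_induct[where k = 0])
  case (step1 i)
  then show ?case using assms[of "x + of_int i"] by (simp add: algebra_simps)
next
  case (step2 i)
  then show ?case using assms[of "x + of_int (i - 1)"] by (simp add: algebra_simps)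
qed simp

text \<open>A translation by the integer part of \<open>t\<close> leaves the window from
  \<open>f\<close> to \<open>f + 1\<close>, with \<open>f\<close> the fractional part. Its piece
  beyond 1 moves back by one period and fills the gap from 0 to \<open>f\<close>.\<close>

lemma nn_integral_periodic_shift:
  fixes g :: "real \<Rightarrow> ennreal"
  assumes [measurable]: "g \<in> borel_measurable borel" and per: "\<And>x. g (x + 1) = g x"
  shows "(\<integral>\<^sup>+x\<in>{t..<t + 1}. g x \<partial>lborel) = (\<integral>\<^sup>+x\<in>{0..<1}. g x \<partial>lborel)"
proof -
  define f where "f = frac t"
  have f: "0 \<le> f" "f < 1" by (simp_all add: f_def frac_lt_1)
  have t: "t = of_int \<lfloor>t\<rfloor> + f" by (simp add: f_def frac_def)
  have "(\<integral>\<^sup>+x\<in>{t..<t + 1}. g x \<partial>lborel)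
      = (\<integral>\<^sup>+x. g (of_int \<lfloor>t\<rfloor> + 1 * x) * indicator {t..<t + 1} (of_int \<lfloor>t\<rfloor> + 1 * x) \<partial>lborel)"
    by (subst nn_integral_real_affine[where c = 1 and t = "of_int \<lfloor>t\<rfloor>"]) auto
  also have "\<dots> = (\<integral>\<^sup>+x\<in>{f..<f + 1}. g x \<partial>lborel)"
  proof (intro nn_integral_cong)
    fix x :: real
    have "g (of_int \<lfloor>t\<rfloor> + x) = g x" using periodic_of_int[of g x, OF per] by (simp add: add.commute)
    then show "g (of_int \<lfloor>t\<rfloor> + 1 * x) * indicator {t..<t + 1} (of_int \<lfloor>t\<rfloor> + 1 * x)
        = g x * indicator {f..<f + 1} x"
      using t by (auto simp: indicator_def)
  qed
  also have "\<dots> = (\<integral>\<^sup>+x. g x * indicator {f..<1} x + g x * indicator {1..<f + 1} x \<partial>lborel)"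
    using f by (intro nn_integral_cong) (auto simp: indicator_def)
  also have "\<dots> = (\<integral>\<^sup>+x\<in>{f..<1}. g x \<partial>lborel) + (\<integral>\<^sup>+x\<in>{1..<f + 1}. g x \<partial>lborel)"
    by (subst nn_integral_add) auto
  also have "(\<integral>\<^sup>+x\<in>{1..<f + 1}. g x \<partial>lborel) 
      = (\<integral>\<^sup>+x. g (1 + 1 * x) * indicator {1..<f + 1} (1 + 1 * x) \<partial>lborel)"
    by (subst nn_integral_real_affine[where c = 1 and t = 1]) auto
  also have "\<dots> = (\<integral>\<^sup>+x\<in>{0..<f}. g x \<partial>lborel)"
    using per by (intro nn_integral_cong) (auto simp: indicator_def add.commute)
  also have "(\<integral>\<^sup>+x\<in>{f..<1}. g x \<partial>lborel) + (\<integral>\<^sup>+x\<in>{0..<f}. g x \<partial>lborel)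
      = (\<integral>\<^sup>+x. g x * indicator {f..<1} x + g x * indicator {0..<f} x \<partial>lborel)"
    by (subst nn_integral_add) auto
  also have "\<dots> = (\<integral>\<^sup>+x\<in>{0..<1}. g x \<partial>lborel)"
    using f by (intro nn_integral_cong) (auto simp: indicator_def)
  finally show ?thesis .
qed

text \<open>The substitution sweeps \<open>k\<close> full periods, and its Jacobian
  \<open>1 / k\<close> compensates for this. The case \<open>k = 1\<close> is translation invariance
  on the circle; larger \<open>k\<close> gives invariance under multiplication by
  \<open>k\<close>.\<close>

lemma nn_integral_periodic_affine:
  fixes g :: "real \<Rightarrow> ennreal"
  assumes [measurable]: "g \<in> borel_measurable borel" and per: "\<And>x. g (x + 1) = g x"
    and k: "k > 0"
  shows "(\<integral>\<^sup>+x\<in>{0..<1}. g (t + real k * x) \<partial>lborel) = (\<integral>\<^sup>+x\<in>{0..<1}. g x \<partial>lborel)"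
proof -
  have block: "(\<integral>\<^sup>+x\<in>{t..<t + real n}. g x \<partial>lborel) = of_nat n * (\<integral>\<^sup>+x\<in>{0..<1}. g x \<partial>lborel)" for n
  proof (induction n)
    case (Suc n)
    have "(\<integral>\<^sup>+x\<in>{t..<t + real (Suc n)}. g x \<partial>lborel)
      = (\<integral>\<^sup>+x. g x * indicator {t..<t + real n} x
            + g x * indicator {t + real n..<t + real n + 1} x \<partial>lborel)"
      by (intro nn_integral_cong) (auto simp: indicator_def)
    also have "\<dots> = (\<integral>\<^sup>+x\<in>{t..<t + real n}. g x \<partial>lborel)
        + (\<integral>\<^sup>+x\<in>{t + real n..<t + real n + 1}. g x \<partial>lborel)"
      by (subst nn_integral_add) auto
    also have "(\<integral>\<^sup>+x\<in>{t + real n..<t + real n + 1}. g x \<partial>lborel) = (\<integral>\<^sup>+x\<in>{0..<1}. g x \<partial>lborel)"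
      by (rule nn_integral_periodic_shift[where g = g, OF _ per]) simp
    finally show ?case
      by (simp add: Suc distrib_right add.commute)
  qed simp
  have "of_nat k * (\<integral>\<^sup>+x\<in>{0..<1}. g x \<partial>lborel) = (\<integral>\<^sup>+x\<in>{t..<t + real k}. g x \<partial>lborel)"
    by (simp add: block)
  also have "\<dots> = \<bar>real k\<bar> * (\<integral>\<^sup>+x. g (t + real k * x) * indicator {t..<t + real k} (t + real k * x) \<partial>lborel)"
    using k by (subst nn_integral_real_affine[where c = "real k" and t = t]) auto
  also have "(\<integral>\<^sup>+x. g (t + real k * x) * indicator {t..<t + real k} (t + real k * x) \<partial>lborel)
      = (\<integral>\<^sup>+x\<in>{0..<1}. g (t + real k * x) \<partial>lborel)"
    using k by (intro nn_integral_cong) (auto simp: indicator_def zero_le_mult_iff)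
  finally show ?thesis
    using k by (simp add: ennreal_mult_cancel_left ennreal_of_nat_eq_real_of_nat)
qed

section \<open>Distance to the nearest integer and the arc around 0\<close>

lemma continuous_on_torus_norm [continuous_intros]:
  "continuous_on S f \<Longrightarrow> continuous_on S (\<lambda>x. torus_norm (f x))"
  unfolding torus_norm_def by (intro continuous_intros)

lemma borel_measurable_torus_norm [measurable]: "torus_norm \<in> borel_measurable borel"
  by (intro borel_measurable_continuous_onI continuous_intros)

lemma torus_norm_minus: "torus_norm (- x) = torus_norm x"
proof -
  have "dist (- x) ` \<int> = dist x ` \<int>"
  proof -
    have "uminus ` (\<int> :: real set) = \<int>" by (force simp: image_iff intro: bexI[where x = "- _"])
    then have "dist (- x) ` \<int> = dist (- x) ` uminus ` \<int>" by simp
    also have "\<dots> = dist x ` \<int>" unfolding image_image dist_minus ..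
    finally show ?thesis .
  qed
  moreover have "(\<int> :: real set) \<noteq> {}" using Ints_0 by blast
  ultimately show ?thesis by (simp add: torus_norm_def infdist_def)
qed

lemma torus_norm_diff_commute: "torus_norm (x - y) = torus_norm (y - x)"
  using torus_norm_minus[of "x - y"] by simp

lemma torus_norm_unit_interval:
  assumes "0 \<le> x" "x \<le> 1"
  shows "torus_norm x = min x (1 - x)"
proof (rule antisym)
  show "torus_norm x \<le> min x (1 - x)"
    using assms infdist_le[of 0 \<int> x] infdist_le[of 1 \<int> x] by (simp add: torus_norm_def dist_real_def)
  have ne: "(\<int> :: real set) \<noteq> {}" using Ints_0 by blast
  show "min x (1 - x) \<le> torus_norm x"
    unfolding torus_norm_def infdist_notempty[OF ne]
  proof (rule cINF_greatest[OF ne])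
    fix y :: real assume "y \<in> \<int>"
    then obtain n where y: "y = of_int n" by (auto elim: Ints_cases)
    consider "n \<le> 0" | "n \<ge> 1" by linarith
    then show "min x (1 - x) \<le> dist x y"
      using assms by cases (auto simp: y dist_real_def)
  qed
qed

text \<open>The arc around 0 as a function on the whole line, hence of period 1; values in
  \<open>ennreal\<close> allow Tonelli's theorem without integrability conditions.\<close>

definition near0 :: "real \<Rightarrow> real \<Rightarrow> ennreal" where
  "near0 \<epsilon> x = indicator {x. torus_norm x \<le> \<epsilon>} x"

lemma near0_measurable [measurable]: "near0 \<epsilon> \<in> borel_measurable borel"
  unfolding near0_def by measurable

lemma near0_periodic: "near0 \<epsilon> (x + 1) = near0 \<epsilon> x"
  by (simp add: near0_def torus_norm_add_Ints indicator_def)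

lemma near0_diff_commute: "near0 \<epsilon> (x - y) = near0 \<epsilon> (y - x)"
  by (simp add: near0_def torus_norm_diff_commute[of x y] indicator_def)

lemma nn_integral_near0:
  assumes "0 \<le> \<epsilon>" "\<epsilon> \<le> 1 / 2"
  shows "(\<integral>\<^sup>+x\<in>{0..<1}. near0 \<epsilon> x \<partial>lborel) = ennreal (2 * \<epsilon>)"
proof -
  have "(\<integral>\<^sup>+x\<in>{0..<1}. near0 \<epsilon> x \<partial>lborel) 
    = (\<integral>\<^sup>+x. indicator {0..\<epsilon>} x + indicator {1 - \<epsilon>..1} x \<partial>lborel)"
  proof (intro nn_integral_cong_AE)
    \<comment> \<open>The two intervals share the point 1/2 when \<open>\<epsilon> = 1 / 2\<close>,
      and the half-open unit interval lacks 1. Both points are null.\<close>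
    have "AE x in lborel. x \<noteq> (1/2::real)" "AE x in lborel. x \<noteq> (1::real)"
      by (rule AE_lborel_singleton)+
    then show "AE x in lborel. near0 \<epsilon> x * indicator {0..<1} x
        = indicator {0..\<epsilon>} x + indicator {1 - \<epsilon>..1} x"
    proof eventually_elim
      case (elim x)
      then show ?case using assms torus_norm_unit_interval[of x]
        by (auto simp: near0_def indicator_def)
    qed
  qed
  also have "\<dots> = ennreal \<epsilon> + ennreal \<epsilon>"
    using assms by (subst nn_integral_add) auto
  finally show ?thesis using assms by (simp flip: ennreal_plus)
qed

text \<open>Cut off at the fundamental domain, so that strips are events of the unit square.\<close>

definition strip :: "real \<Rightarrow> int \<Rightarrow> (real \<times> real) set" where
  "strip \<epsilon> d = {(\<alpha>, \<gamma>) \<in> {0..<1} \<times> {0..<1}. torus_norm (of_int d * \<alpha> - \<gamma>) \<le> \<epsilon>}"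

lemma unit_square_borel: "{0..<1} \<times> {0..<1} \<in> sets (borel :: (real \<times> real) measure)"
  by (subst borel_prod[symmetric]) (auto intro!: pair_measureI)

lemma strip_borel [measurable]: "strip \<epsilon> d \<in> sets borel"
proof -
  have "strip \<epsilon> d = ({0..<1} \<times> {0..<1}) \<inter> {z. torus_norm (of_int d * fst z - snd z) \<le> \<epsilon>}"
    by (auto simp: strip_def)
  moreover have "closed {z :: real \<times> real. torus_norm (of_int d * fst z - snd z) \<le> \<epsilon>}"
    by (intro closed_Collect_le continuous_intros)
  ultimately show ?thesis using unit_square_borel by auto
qed

lemma emeasure_lborel_prod:
  fixes S :: "(real \<times> real) set"
  assumes "S \<in> sets borel"
  shows "emeasure lborel S = (\<integral>\<^sup>+\<alpha>. (\<integral>\<^sup>+\<gamma>. indicator S (\<alpha>, \<gamma>) \<partial>lborel) \<partial>lborel)"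
proof -
  have "emeasure lborel S = (\<integral>\<^sup>+z. indicator S z \<partial>(lborel \<Otimes>\<^sub>M lborel))"
    using assms by (simp add: lborel_prod)
  also have "\<dots> = (\<integral>\<^sup>+\<alpha>. (\<integral>\<^sup>+\<gamma>. indicator S (\<alpha>, \<gamma>) \<partial>lborel) \<partial>lborel)"
    by (rule lborel.nn_integral_fst[symmetric]) (use assms in \<open>simp add: lborel_prod\<close>)
  finally show ?thesis .
qed

text \<open>Each section at fixed \<open>\<alpha>\<close> is the arc of half-width
  \<open>\<epsilon>\<close> translated by \<open>d \<alpha>\<close>, and translation preserves its
  length.\<close>

lemma emeasure_strip:
  assumes "0 \<le> \<epsilon>" "\<epsilon> \<le> 1 / 2"
  shows "emeasure lborel (strip \<epsilon> d) = ennreal (2 * \<epsilon>)"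
proof -
  have "emeasure lborel (strip \<epsilon> d)
      = (\<integral>\<^sup>+\<alpha>. (\<integral>\<^sup>+\<gamma>\<in>{0..<1}. near0 \<epsilon> (- of_int d * \<alpha> + real 1 * \<gamma>) \<partial>lborel) * indicator {0..<1} \<alpha> \<partial>lborel)"
    unfolding emeasure_lborel_prod[OF strip_borel]
  proof (subst nn_integral_multc[symmetric], measurable, intro nn_integral_cong)
    fix \<alpha> \<gamma> :: real
    show "indicator (strip \<epsilon> d) (\<alpha>, \<gamma>)
      = near0 \<epsilon> (- of_int d * \<alpha> + real 1 * \<gamma>) * indicator {0..<1} \<gamma> * indicator {0..<1} \<alpha>"
      using near0_diff_commute[of \<epsilon> \<gamma> "of_int d * \<alpha>"]
      by (auto simp: strip_def near0_def indicator_def)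
  qed
  also have "\<dots> = ennreal (2 * \<epsilon>)"
    by (subst nn_integral_periodic_affine[where g = "near0 \<epsilon>", OF _ near0_periodic])
       (auto simp: nn_integral_near0[OF assms] nn_integral_cmult_indicator)
  finally show ?thesis .
qed

text \<open>Translating \<open>\<gamma>\<close> by \<open>d \<alpha>\<close> turns the two
  conditions into conditions on \<open>\<gamma>\<close> and \<open>\<gamma> - k \<alpha>\<close>
  with \<open>k = e - d > 0\<close>. After the order of integration is exchanged, the integral over
  \<open>\<alpha>\<close> is \<open>2 * \<epsilon>\<close> for every \<open>\<gamma>\<close>, so the
  two factors separate.\<close>

lemma emeasure_strip_Int_less:
  assumes "0 \<le> \<epsilon>" "\<epsilon> \<le> 1 / 2" "d < e"
  shows "emeasure lborel (strip \<epsilon> d \<inter> strip \<epsilon> e) = ennreal ((2 * \<epsilon>)\<^sup>2)"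
proof -
  define k where "k = nat (e - d)"
  have k: "k > 0" "of_int e = of_int d + real k" using assms by (auto simp: k_def)
  define I where "I = (indicator {0..<1} :: real \<Rightarrow> ennreal)"
  have [measurable]: "I \<in> borel_measurable borel" by (simp add: I_def)
  \<comment> \<open>Symmetry gives \<open>\<alpha>\<close> the positive coefficient \<open>k\<close>
    that the affine substitution requires.\<close>
  have flip: "near0 \<epsilon> (\<gamma> - real k * \<alpha>) = near0 \<epsilon> (- \<gamma> + real k * \<alpha>)" for \<alpha> \<gamma>
    using near0_diff_commute[of \<epsilon> \<gamma> "real k * \<alpha>"] by simp
  have "emeasure lborel (strip \<epsilon> d \<inter> strip \<epsilon> e)
      = (\<integral>\<^sup>+\<alpha>. (\<integral>\<^sup>+\<gamma>. near0 \<epsilon> (\<gamma> - of_int d * \<alpha>) * near0 \<epsilon> (\<gamma> - of_int e * \<alpha>) * I \<gamma> \<partial>lborel) * I \<alpha> \<partial>lborel)"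
    by (subst emeasure_lborel_prod, measurable, subst nn_integral_multc[symmetric], measurable,
        intro nn_integral_cong)
       (auto simp: strip_def torus_norm_diff_commute[of "of_int _ * _"] I_def near0_def indicator_def)
  also have "\<dots> = (\<integral>\<^sup>+\<alpha>. (\<integral>\<^sup>+\<gamma>. near0 \<epsilon> \<gamma> * near0 \<epsilon> (\<gamma> - real k * \<alpha>) * I \<gamma> \<partial>lborel) * I \<alpha> \<partial>lborel)"
  proof (rule nn_integral_cong)
    fix \<alpha> :: real
    define g where "g = (\<lambda>\<gamma>. near0 \<epsilon> \<gamma> * near0 \<epsilon> (\<gamma> - real k * \<alpha>))"
    have "g (x + 1) = g x" for x
      using near0_periodic[of \<epsilon> x] near0_periodic[of \<epsilon> "x - real k * \<alpha>"]
      by (simp add: g_def algebra_simps)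
    moreover have "g \<in> borel_measurable borel" unfolding g_def by measurable
    ultimately have "(\<integral>\<^sup>+\<gamma>\<in>{0..<1}. g (- of_int d * \<alpha> + real 1 * \<gamma>) \<partial>lborel) = (\<integral>\<^sup>+\<gamma>\<in>{0..<1}. g \<gamma> \<partial>lborel)"
      by (intro nn_integral_periodic_affine) auto
    then show "(\<integral>\<^sup>+\<gamma>. near0 \<epsilon> (\<gamma> - of_int d * \<alpha>) * near0 \<epsilon> (\<gamma> - of_int e * \<alpha>) * I \<gamma> \<partial>lborel) * I \<alpha>
        = (\<integral>\<^sup>+\<gamma>. near0 \<epsilon> \<gamma> * near0 \<epsilon> (\<gamma> - real k * \<alpha>) * I \<gamma> \<partial>lborel) * I \<alpha>"
      by (simp add: g_def I_def k algebra_simps)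
  qed
  also have "\<dots> = (\<integral>\<^sup>+\<alpha>. (\<integral>\<^sup>+\<gamma>. near0 \<epsilon> \<gamma> * near0 \<epsilon> (\<gamma> - real k * \<alpha>) * I \<gamma> * I \<alpha> \<partial>lborel) \<partial>lborel)"
    by (subst nn_integral_multc) auto
  also have "\<dots> = (\<integral>\<^sup>+\<gamma>. (\<integral>\<^sup>+\<alpha>. near0 \<epsilon> \<gamma> * near0 \<epsilon> (\<gamma> - real k * \<alpha>) * I \<gamma> * I \<alpha> \<partial>lborel) \<partial>lborel)"
    by (rule lborel_pair.Fubini') measurable
  also have "\<dots> = (\<integral>\<^sup>+\<gamma>. near0 \<epsilon> \<gamma> * I \<gamma> * (\<integral>\<^sup>+\<alpha>\<in>{0..<1}. near0 \<epsilon> (- \<gamma> + real k * \<alpha>) \<partial>lborel) \<partial>lborel)"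
    unfolding flip by (subst nn_integral_cmult[symmetric], measurable, intro nn_integral_cong)
       (simp add: I_def mult_ac)
  also have "\<dots> = ennreal (2 * \<epsilon>) * ennreal (2 * \<epsilon>)"
    by (subst nn_integral_periodic_affine[where g = "near0 \<epsilon>", OF _ near0_periodic k(1)])
       (simp_all add: nn_integral_multc nn_integral_near0[OF assms(1,2)] I_def)
  also have "\<dots> = ennreal ((2 * \<epsilon>)\<^sup>2)"
    unfolding power2_eq_square by (rule ennreal_mult[symmetric]) (use assms in auto)
  finally show ?thesis .
qed

lemma emeasure_strip_Int:
  assumes "0 \<le> \<epsilon>" "\<epsilon> \<le> 1 / 2" "d \<noteq> e"
  shows "emeasure lborel (strip \<epsilon> d \<inter> strip \<epsilon> e) = ennreal ((2 * \<epsilon>)\<^sup>2)"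
  using emeasure_strip_Int_less[of \<epsilon> d e] emeasure_strip_Int_less[of \<epsilon> e d] assms
  by (cases "d < e") (auto simp: Int_commute)

section \<open>Pairwise independent events\<close>

context prob_space
begin

text \<open>In the expanded square the covariances of distinct events vanish, and only the diagonal
  terms with variance \<open>p * (1 - p)\<close> remain.\<close>

lemma second_moment_pairwise_independent:
  fixes w :: "'i \<Rightarrow> real"
  assumes "finite D" and S: "\<And>d. d \<in> D \<Longrightarrow> S d \<in> events"
    and p: "\<And>d. d \<in> D \<Longrightarrow> prob (S d) = p"
    and pp: "\<And>d e. d \<in> D \<Longrightarrow> e \<in> D \<Longrightarrow> d \<noteq> e \<Longrightarrow> prob (S d \<inter> S e) = p\<^sup>2"
  shows "expectation (\<lambda>x. (\<Sum>d\<in>D. w d * (indicator (S d) x - p))\<^sup>2) = p * (1 - p) * (\<Sum>d\<in>D. (w d)\<^sup>2)"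
    and "integrable M (\<lambda>x. (\<Sum>d\<in>D. w d * (indicator (S d) x - p))\<^sup>2)"
proof -
  \<comment> \<open>\<open>c d e\<close> is the product of the two centred indicators, multiplied
    out.\<close>
  define c where "c = (\<lambda>d e x. indicator (S d \<inter> S e) x - p * indicator (S d) x - p * indicator (S e) x + p\<^sup>2 :: real)"
  have sq: "(\<Sum>d\<in>D. w d * (indicator (S d) x - p))\<^sup>2 = (\<Sum>d\<in>D. \<Sum>e\<in>D. w d * w e * c d e x)" for x
    unfolding power2_eq_square[of "sum _ _"] sum_product c_def
    by (intro sum.cong refl) (simp add: indicator_inter_arith algebra_simps power2_eq_square)
  have c_int: "integrable M (c d e)"
    and c_exp: "expectation (c d e) = (if e = d then p * (1 - p) else 0)" if "d \<in> D" "e \<in> D" for d e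
  proof -
    have [simp]: "integrable M (indicator (S d) :: _ \<Rightarrow> real)" "integrable M (indicator (S e) :: _ \<Rightarrow> real)"
      "integrable M (indicator (S d \<inter> S e) :: _ \<Rightarrow> real)"
      using that S by (auto simp: integrable_indicator_iff less_top[symmetric])
    show "integrable M (c d e)" unfolding c_def by simp
    show "expectation (c d e) = (if e = d then p * (1 - p) else 0)"
      using that S p pp sets.sets_into_space[OF S]
      by (auto simp: c_def prob_space power2_eq_square algebra_simps Int_absorb2)
  qed
  show "integrable M (\<lambda>x. (\<Sum>d\<in>D. w d * (indicator (S d) x - p))\<^sup>2)"
    unfolding sq using c_int by (auto intro!: integrable_sum)
  have "expectation (\<lambda>x. (\<Sum>d\<in>D. w d * (indicator (S d) x - p))\<^sup>2)
      = (\<Sum>d\<in>D. \<Sum>e\<in>D. w d * w e * expectation (c d e))"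
    unfolding sq using c_int by simp
  also have "\<dots> = (\<Sum>d\<in>D. \<Sum>e\<in>D. if e = d then w d * w d * (p * (1 - p)) else 0)"
    by (intro sum.cong refl) (auto simp: c_exp)
  also have "\<dots> = p * (1 - p) * (\<Sum>d\<in>D. (w d)\<^sup>2)"
    using \<open>finite D\<close> by (simp add: sum_distrib_left power2_eq_square mult_ac)
  finally show "expectation (\<lambda>x. (\<Sum>d\<in>D. w d * (indicator (S d) x - p))\<^sup>2) = p * (1 - p) * (\<Sum>d\<in>D. (w d)\<^sup>2)" .
qed

text \<open>Pointwise, \<open>3 G - G\<^sup>2 \<le> 2\<close> for the number \<open>G\<close> of events that occur, because \<open>G\<close> is an integer.\<close>

lemma prob_UN_pairwise_independent_ge:
  assumes "finite D" and S: "\<And>d. d \<in> D \<Longrightarrow> S d \<in> events"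
    and p: "\<And>d. d \<in> D \<Longrightarrow> prob (S d) = p"
    and pp: "\<And>d e. d \<in> D \<Longrightarrow> e \<in> D \<Longrightarrow> d \<noteq> e \<Longrightarrow> prob (S d \<inter> S e) = p\<^sup>2"
  shows "prob (\<Union>d\<in>D. S d) \<ge> real (card D) * p - (real (card D) * p)\<^sup>2 / 2"
proof -
  define n where "n = real (card D)"
  define G where "G = (\<lambda>x. \<Sum>d\<in>D. indicator (S d) x :: real)"
  define Y where "Y = (\<lambda>x. (\<Sum>d\<in>D. 1 * (indicator (S d) x - p))\<^sup>2)"
  have Y: "Y x = (G x - n * p)\<^sup>2" for x
    by (simp add: Y_def G_def n_def sum_subtractf)
  have Y_int: "integrable M Y" "expectation Y = p * (1 - p) * n"
    using second_moment_pairwise_independent[OF assms, where w = "\<lambda>_. 1"] by (simp_all add: Y_def n_def)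
  have ind: "integrable M (indicator (S d) :: _ \<Rightarrow> real)" "expectation (indicator (S d)) = p" if "d \<in> D" for d
    using that S p sets.sets_into_space[OF S[OF that]]
    by (auto simp: integrable_indicator_iff less_top[symmetric] Int_absorb2)
  have G_int: "integrable M G" "expectation G = n * p"
    using ind by (simp_all add: G_def n_def)
  have U: "(\<Union>d\<in>D. S d) \<in> events"
    using assms by (intro sets.finite_UN) auto
  have U_int: "integrable M (indicator (\<Union>d\<in>D. S d) :: _ \<Rightarrow> real)"
    "expectation (indicator (\<Union>d\<in>D. S d)) = prob (\<Union>d\<in>D. S d)"
    using U sets.sets_into_space[OF U] by (auto simp: integrable_indicator_iff less_top[symmetric] Int_absorb2)
  \<comment> \<open>The left integrand equals \<open>3 G - G^2\<close>. In this form its expectation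
    follows from the mean of \<open>G\<close> and that of \<open>Y\<close>.\<close>
  have "expectation (\<lambda>x. (3 - 2 * (n * p)) * G x + (n * p)\<^sup>2 - Y x) \<le> expectation (\<lambda>x. 2 * indicator (\<Union>d\<in>D. S d) x)"
  proof (rule integral_mono)
    fix x
    define m where "m = card {d \<in> D. x \<in> S d}"
    have G: "G x = real m"
      using \<open>finite D\<close> by (simp add: G_def m_def indicator_def sum.If_cases Int_def conj_commute)
    have "(3 - 2 * (n * p)) * G x + (n * p)\<^sup>2 - Y x = 3 * G x - (G x)\<^sup>2"
      by (simp add: Y power2_eq_square algebra_simps)
    also have "\<dots> \<le> 2 * indicator (\<Union>d\<in>D. S d) x"
    proof (cases "x \<in> (\<Union>d\<in>D. S d)")
      case True
      have "0 \<le> (int m - 1) * (int m - 2)"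
        by (cases "int m \<le> 1") (auto intro: mult_nonpos_nonpos mult_nonneg_nonneg)
      then have "0 \<le> real_of_int ((int m - 1) * (int m - 2))"
        by (simp only: of_int_0_le_iff)
      then have "0 \<le> (real m - 1) * (real m - 2)"
        by simp
      with True show ?thesis by (simp add: G power2_eq_square algebra_simps)
    qed (auto simp: G_def)
    finally show "(3 - 2 * (n * p)) * G x + (n * p)\<^sup>2 - Y x \<le> 2 * indicator (\<Union>d\<in>D. S d) x" .
  qed (use Y_int G_int U_int in auto)
  also have "expectation (\<lambda>x. (3 - 2 * (n * p)) * G x + (n * p)\<^sup>2 - Y x)
      = (3 - 2 * (n * p)) * (n * p) + (n * p)\<^sup>2 - p * (1 - p) * n"
    using Y_int G_int by (simp add: prob_space)
  finally have "2 * (n * p) - (n * p)\<^sup>2 + n * p\<^sup>2 \<le> 2 * prob (\<Union>d\<in>D. S d)"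
    using U_int by (simp add: power2_eq_square algebra_simps)
  moreover have "0 \<le> n * p\<^sup>2" by (simp add: n_def)
  ultimately show ?thesis unfolding n_def by linarith
qed

end

section \<open>The unit square as a probability space\<close>

abbreviation unit_square :: "(real \<times> real) measure" where
  "unit_square \<equiv> lebesgue_on ({0..<1} \<times> {0..<1})"

text \<open>Carries the Borel computations above over to the completed and restricted
  measure.\<close>

lemma borel_in_unit_square:
  assumes "S \<in> sets borel" "S \<subseteq> {0..<1} \<times> {0..<1}"
  shows "S \<in> sets unit_square" "measure unit_square S = measure lborel S"
  using assms unit_square_borel
  by (auto simp: sets_restrict_space_iff measure_restrict_space intro: sets_completionI_sets)

lemma prob_space_unit_square: "prob_space unit_square"
proof
  have "emeasure unit_square (space unit_square) = emeasure (lborel \<Otimes>\<^sub>M lborel) ({0..<1::real} \<times> {0..<1::real})"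
    using unit_square_borel by (simp add: emeasure_restrict_space lborel_prod space_restrict_space)
  also have "\<dots> = emeasure lborel {0..<1::real} * emeasure lborel {0..<1::real}"
    by (rule lborel.emeasure_pair_measure_Times) auto
  finally show "emeasure unit_square (space unit_square) = 1" by simp
qed

lemma strip_events [measurable]: "strip \<epsilon> d \<in> sets unit_square"
  by (rule borel_in_unit_square(1)[OF strip_borel]) (auto simp: strip_def)

lemma prob_strip:
  assumes "0 \<le> \<epsilon>" "\<epsilon> \<le> 1 / 2"
  shows "measure unit_square (strip \<epsilon> d) = 2 * \<epsilon>"
proof -
  have "strip \<epsilon> d \<subseteq> {0..<1} \<times> {0..<1}" by (auto simp: strip_def)
  then show ?thesis
    using borel_in_unit_square(2)[OF strip_borel, of \<epsilon> d] emeasure_strip[OF assms, of d] assms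
    by (simp add: measure_def)
qed

lemma prob_strip_Int:
  assumes "0 \<le> \<epsilon>" "\<epsilon> \<le> 1 / 2" "d \<noteq> e"
  shows "measure unit_square (strip \<epsilon> d \<inter> strip \<epsilon> e) = (2 * \<epsilon>)\<^sup>2"
proof -
  have "strip \<epsilon> d \<inter> strip \<epsilon> e \<subseteq> {0..<1} \<times> {0..<1}" by (auto simp: strip_def)
  then show ?thesis
    using borel_in_unit_square(2)[of "strip \<epsilon> d \<inter> strip \<epsilon> e"] emeasure_strip_Int[OF assms]
    by (simp add: measure_def)
qed

section \<open>Differences and additive energy\<close>

text \<open>Integer-valued, since subtraction on \<open>nat\<close> truncates.\<close>

definition pair_diff :: "nat \<times> nat \<Rightarrow> int" where
  "pair_diff z = int (fst z) - int (snd z)"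

definition diff_count :: "nat set \<Rightarrow> int \<Rightarrow> nat" where
  "diff_count B d = card {z \<in> B \<times> B. pair_diff z = d}"

definition nonzero_diffs :: "nat set \<Rightarrow> int set" where
  "nonzero_diffs B = pair_diff ` (B \<times> B) - {0}"

lemma finite_nonzero_diffs [simp]: "finite B \<Longrightarrow> finite (nonzero_diffs B)"
  by (simp add: nonzero_diffs_def)

lemma zero_notin_nonzero_diffs [simp]: "0 \<notin> nonzero_diffs B"
  by (simp add: nonzero_diffs_def)

text \<open>Serves twice: for all pairs from \<open>B\<close>, and for the pairs that the pair
  correlation counts, among which none has difference 0.\<close>

lemma card_pair_diff_fibres:
  assumes "finite B" "C \<subseteq> B \<times> B"
  shows "card C = card {z \<in> C. pair_diff z = 0} + (\<Sum>d\<in>nonzero_diffs B. card {z \<in> C. pair_diff z = d})"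
proof -
  have "finite C" using assms finite_subset by blast
  moreover have "pair_diff ` C \<subseteq> insert 0 (nonzero_diffs B)"
    using assms by (auto simp: nonzero_diffs_def)
  ultimately have "card C = (\<Sum>d\<in>insert 0 (nonzero_diffs B). card {z \<in> C. pair_diff z = d})"
    using assms sum.group[of C "insert 0 (nonzero_diffs B)" pair_diff "\<lambda>_. 1 :: nat"] by simp
  then show ?thesis using assms by simp
qed

lemma diff_count_0: "diff_count B 0 = card B"
  unfolding diff_count_def
  by (rule bij_betw_same_card[of fst]) (auto simp: bij_betw_def inj_on_def pair_diff_def image_iff)

lemma sum_diff_count:
  assumes "finite B"
  shows "(\<Sum>d\<in>nonzero_diffs B. diff_count B d) + card B = (card B)\<^sup>2"
  using card_pair_diff_fibres[OF assms order_refl] diff_count_0[of B] assms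
  by (simp add: diff_count_def power2_eq_square card_cartesian_product)

lemma diff_count_le:
  assumes "finite B"
  shows "diff_count B d \<le> card B"
  unfolding diff_count_def
  by (rule card_inj_on_le[of fst]) (use assms in \<open>auto simp: inj_on_def pair_diff_def\<close>)

text \<open>The equation \<open>a + b = c + d\<close> says that the pairs \<open>(a, c)\<close> and \<open>(d, b)\<close> have the same difference.\<close>

lemma additive_energy_eq_sum_diff_count:
  assumes "finite B"
  shows "additive_energy B = (\<Sum>d\<in>nonzero_diffs B. (diff_count B d)\<^sup>2) + (card B)\<^sup>2"
proof -
  let ?P = "B \<times> B"
  have fin: "finite ?P" using assms by simp
  have "additive_energy B = card (SIGMA u:?P. {v \<in> ?P. pair_diff v = pair_diff u})"
    unfolding additive_energy_def
    by (rule bij_betw_same_card[OF bij_betwI[where f = "\<lambda>(a, b, c, d). ((a, c), (d, b))"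
        and g = "\<lambda>((a, c), (d, b)). (a, b, c, d)"]]) (auto simp: pair_diff_def)
  also have "\<dots> = (\<Sum>u\<in>?P. diff_count B (pair_diff u))"
    using fin by (subst card_SigmaI) (auto simp: diff_count_def)
  \<comment> \<open>Each of the \<open>diff_count B d\<close> pairs with difference \<open>d\<close>
    contributes \<open>diff_count B d\<close>; the difference 0 yields the separate square of
    \<open>card B\<close>.\<close>
  also have "\<dots> = (\<Sum>d\<in>insert 0 (nonzero_diffs B). \<Sum>u\<in>{u \<in> ?P. pair_diff u = d}. diff_count B (pair_diff u))"
    using assms by (intro sum.group[symmetric]) (auto simp: nonzero_diffs_def)
  also have "\<dots> = (\<Sum>d\<in>insert 0 (nonzero_diffs B). (diff_count B d)\<^sup>2)"
    by (intro sum.cong refl) (simp add: diff_count_def power2_eq_square)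
  finally show ?thesis using assms by (simp add: diff_count_0)
qed

section \<open>Pair correlation as a weighted sum of strip indicators\<close>

lemma image_Collect_mem: "f ` {z \<in> X. f z \<in> C} = f ` X \<inter> C"
  by blast

lemma elt_bij_betw:
  assumes "infinite A"
  shows "bij_betw (elt A) {1..N} (first_elts A N)"
proof -
  have "inj_on (elt A) {1..N}"
  proof (rule inj_onI)
    fix i j assume "i \<in> {1..N}" "j \<in> {1..N}" "elt A i = elt A j"
    moreover from this have "i - 1 = j - 1"
      unfolding elt_def using injD[OF inj_enumerate[OF assms]] by blast
    \<comment> \<open>Truncated subtraction makes \<open>elt A 0\<close> and \<open>elt A 1\<close>
      coincide, so it matters that both indices are at least 1.\<close>
    ultimately show "i = j" unfolding atLeastAtMost_iff by linarith
  qed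
  then show ?thesis by (simp add: first_elts_def bij_betw_def)
qed

lemma finite_first_elts [simp]: "finite (first_elts A N)"
  by (simp add: first_elts_def)

lemma card_first_elts: "infinite A \<Longrightarrow> card (first_elts A N) = N"
  using bij_betw_same_card[OF elt_bij_betw] by fastforce

text \<open>The enumeration carries index pairs bijectively to pairs of elements, which are then
  grouped by difference. Distinct indices give distinct elements, so the difference 0 is
  absent.\<close>

lemma pair_corr_eq_sum_strips:
  fixes N :: nat
  assumes "infinite A" "\<alpha> \<in> {0..<1}" "\<gamma> \<in> {0..<1}"
  defines "B \<equiv> first_elts A N"
  shows "pair_corr \<alpha> \<gamma> s N A
    = (\<Sum>d\<in>nonzero_diffs B. real (diff_count B d) / real N * indicator (strip (s / real N) d) (\<alpha>, \<gamma>))"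
proof -
  define C where "C = {z \<in> B \<times> B. fst z \<noteq> snd z \<and> torus_norm (of_int (pair_diff z) * \<alpha> - \<gamma>) \<le> s / real N}"
  have fin: "finite B" by (simp add: B_def)
  have bij: "bij_betw (map_prod (elt A) (elt A)) ({1..N} \<times> {1..N}) (B \<times> B)"
    unfolding B_def using elt_bij_betw[OF assms(1)] by (intro bij_betw_map_prod)
  have "card {(i, j) \<in> {1..N} \<times> {1..N}. i \<noteq> j \<and>
        torus_norm (real (elt A i) * \<alpha> - real (elt A j) * \<alpha> - \<gamma>) \<le> s / real N} = card C"
  proof (rule bij_betw_same_card, rule bij_betw_subset[OF bij])
    have "elt A i = elt A j \<longleftrightarrow> i = j" if "i \<in> {1..N}" "j \<in> {1..N}" for i j
      using inj_onD[OF bij_betw_imp_inj_on[OF elt_bij_betw[OF assms(1), of N]], of i j] that by auto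
    moreover have diff: "real (elt A i) * \<alpha> - real (elt A j) * \<alpha> - \<gamma>
        = of_int (pair_diff (elt A i, elt A j)) * \<alpha> - \<gamma>" for i j
      by (simp add: pair_diff_def algebra_simps)
    moreover have "elt A i \<in> B" if "i \<in> {1..N}" for i
      using that by (simp add: B_def first_elts_def)
    ultimately have "{(i, j) \<in> {1..N} \<times> {1..N}. i \<noteq> j \<and>
        torus_norm (real (elt A i) * \<alpha> - real (elt A j) * \<alpha> - \<gamma>) \<le> s / real N}
        = {z \<in> {1..N} \<times> {1..N}. map_prod (elt A) (elt A) z \<in> C}"
      unfolding C_def diff by auto
    moreover have "map_prod (elt A) (elt A) ` {z \<in> {1..N} \<times> {1..N}. map_prod (elt A) (elt A) z \<in> C}
        = map_prod (elt A) (elt A) ` ({1..N} \<times> {1..N}) \<inter> C"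
      by (rule image_Collect_mem)
    moreover have "B \<times> B \<inter> C = C" by (auto simp: C_def)
    ultimately show "map_prod (elt A) (elt A) ` {(i, j) \<in> {1..N} \<times> {1..N}. i \<noteq> j \<and>
        torus_norm (real (elt A i) * \<alpha> - real (elt A j) * \<alpha> - \<gamma>) \<le> s / real N} = C"
      by (simp only: bij_betw_imp_surj_on[OF bij])
  qed auto
  moreover have "card C = card {z \<in> C. pair_diff z = 0} + (\<Sum>d\<in>nonzero_diffs B. card {z \<in> C. pair_diff z = d})"
    using fin by (intro card_pair_diff_fibres) (auto simp: C_def)
  moreover have "{z \<in> C. pair_diff z = 0} = {}" by (auto simp: C_def pair_diff_def)
  moreover have "real (card {z \<in> C. pair_diff z = d})
      = real (diff_count B d) * indicator (strip (s / real N) d) (\<alpha>, \<gamma>)" if "d \<in> nonzero_diffs B" for d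
  proof (cases "torus_norm (of_int d * \<alpha> - \<gamma>) \<le> s / real N")
    case True
    have "x \<noteq> y" if "pair_diff (x, y) = d" for x y
      using that \<open>d \<in> nonzero_diffs B\<close> by (auto simp: pair_diff_def)
    then have "{z \<in> C. pair_diff z = d} = {z \<in> B \<times> B. pair_diff z = d}"
      using True by (auto simp: C_def)
    then show ?thesis using True assms by (simp add: diff_count_def strip_def)
  next
    case False
    then have "{z \<in> C. pair_diff z = d} = {}" by (auto simp: C_def)
    then show ?thesis using False by (simp only: card.empty strip_def) simp
  qed
  ultimately show ?thesis
    by (simp add: pair_corr_def sum_divide_distrib)
qed

section \<open>Pair correlations\<close>

interpretation unit_square: prob_space unit_square
  by (rule prob_space_unit_square)

lemma mem_space_unit_square: "z \<in> space unit_square \<longleftrightarrow> fst z \<in> {0..<1} \<and> snd z \<in> {0..<1}"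
  by (cases z) (simp add: space_restrict_space)

text \<open>Chebyshev's inequality, as \<open>X\<close> is the weighted strip sum minus its mean.
  The bound \<open>2 * s \<le> real N\<close> keeps the half-width \<open>s / N\<close> at most 1/2,
  where a strip has measure \<open>2 s / N\<close>.\<close>

lemma prob_pair_corr_deviation_le:
  assumes "infinite A" "N > 0" "s > 0" "2 * s \<le> real N" "a > 0"
  defines "X \<equiv> \<lambda>z. pair_corr (fst z) (snd z) s N A - 2 * s * (1 - 1 / real N)"
  shows "{z \<in> space unit_square. \<bar>X z\<bar> \<ge> a} \<in> sets unit_square"
    and "measure unit_square {z \<in> space unit_square. \<bar>X z\<bar> \<ge> a}
      \<le> 2 * s * (real (additive_energy (first_elts A N)) / real N ^ 3) / a\<^sup>2"
proof -
  define B where "B = first_elts A N"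
  define D where "D = nonzero_diffs B"
  define p where "p = 2 * (s / real N)"
  define w where "w = (\<lambda>d. real (diff_count B d) / real N)"
  define Y where "Y = (\<lambda>z. \<Sum>d\<in>D. w d * (indicator (strip (s / real N) d) z - p))"
  have fin: "finite B" "finite D" by (simp_all add: B_def D_def)
  have cardB: "card B = N" using assms by (simp add: B_def card_first_elts)
  have p: "0 \<le> p" "p \<le> 1" using assms by (simp_all add: p_def field_simps)
  have \<epsilon>: "0 \<le> s / real N" "s / real N \<le> 1 / 2" using assms by (simp_all add: field_simps)
  have "(\<Sum>d\<in>D. diff_count B d) + N = N\<^sup>2"
    using sum_diff_count[OF fin(1)] by (simp add: D_def cardB)
  then have sum_D: "(\<Sum>d\<in>D. real (diff_count B d)) = real N ^ 2 - real N"
    by (metis add_diff_cancel_right' of_nat_add of_nat_power of_nat_sum)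
  have "(\<Sum>d\<in>D. w d) = (\<Sum>d\<in>D. real (diff_count B d)) / real N"
    by (simp add: w_def sum_divide_distrib)
  also have "\<dots> = real N - 1"
    unfolding sum_D using \<open>N > 0\<close> by (simp add: field_simps power2_eq_square)
  finally have sum_w: "(\<Sum>d\<in>D. w d) = real N - 1" .
  \<comment> \<open>Only the \<open>N^2 - N\<close> off-diagonal pairs count, whence the factor
    \<open>1 - 1 / N\<close>.\<close>
  have mean: "(\<Sum>d\<in>D. w d) * p = 2 * s * (1 - 1 / real N)"
    unfolding sum_w using \<open>N > 0\<close> by (simp add: p_def field_simps)
  have XY: "X z = Y z" if "z \<in> space unit_square" for z
  proof -
    have "Y z = (\<Sum>d\<in>D. w d * indicator (strip (s / real N) d) z) - (\<Sum>d\<in>D. w d) * p"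
      by (simp add: Y_def right_diff_distrib sum_subtractf sum_distrib_right)
    moreover have "fst z \<in> {0..<1}" "snd z \<in> {0..<1}"
      using that unfolding mem_space_unit_square by blast+
    ultimately show ?thesis
      using pair_corr_eq_sum_strips[OF assms(1), of "fst z" "snd z" s N]
      unfolding mean by (simp only: X_def D_def B_def w_def prod.collapse)
  qed
  have [measurable]: "Y \<in> borel_measurable unit_square"
    unfolding Y_def by measurable
  have eq: "{z \<in> space unit_square. \<bar>X z\<bar> \<ge> a} = {z \<in> space unit_square. \<bar>Y z\<bar> \<ge> a}"
    using XY by auto
  show "{z \<in> space unit_square. \<bar>X z\<bar> \<ge> a} \<in> sets unit_square"
    unfolding eq by measurable
  have moment: "unit_square.expectation (\<lambda>z. (Y z)\<^sup>2) = p * (1 - p) * (\<Sum>d\<in>D. (w d)\<^sup>2)"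
    "integrable unit_square (\<lambda>z. (Y z)\<^sup>2)"
    unfolding Y_def
    by (rule unit_square.second_moment_pairwise_independent;
        simp add: fin p_def prob_strip[OF \<epsilon>] prob_strip_Int[OF \<epsilon>])+
  have "measure unit_square {z \<in> space unit_square. \<bar>X z\<bar> \<ge> a} \<le> (p * (1 - p) * (\<Sum>d\<in>D. (w d)\<^sup>2)) / a\<^sup>2"
    unfolding eq moment(1)[symmetric]
    using moment(2) \<open>a > 0\<close> by (intro unit_square.second_moment_method) auto
  also have "\<dots> \<le> (p * (\<Sum>d\<in>D. (w d)\<^sup>2)) / a\<^sup>2"
    using p by (intro divide_right_mono mult_right_mono mult_left_le sum_nonneg) auto
  also have "\<dots> \<le> 2 * s * (real (additive_energy B) / real N ^ 3) / a\<^sup>2"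
  proof (rule divide_right_mono)
    have "(\<Sum>d\<in>D. (w d)\<^sup>2) = (\<Sum>d\<in>D. real ((diff_count B d)\<^sup>2)) / real N ^ 2"
      by (simp add: w_def power_divide sum_divide_distrib)
    \<comment> \<open>The energy exceeds the sum by the square of \<open>card B\<close>, the
      contribution of the difference 0.\<close>
    also have "\<dots> \<le> real (additive_energy B) / real N ^ 2"
      unfolding additive_energy_eq_sum_diff_count[OF fin(1)] D_def by (intro divide_right_mono) auto
    finally have "p * (\<Sum>d\<in>D. (w d)\<^sup>2) \<le> p * (real (additive_energy B) / real N ^ 2)"
      using p by (intro mult_left_mono)
    then show "p * (\<Sum>d\<in>D. (w d)\<^sup>2) \<le> 2 * s * (real (additive_energy B) / real N ^ 3)"
      by (simp add: p_def power3_eq_cube power2_eq_square mult_ac)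
  qed simp
  finally show "measure unit_square {z \<in> space unit_square. \<bar>X z\<bar> \<ge> a}
      \<le> 2 * s * (real (additive_energy (first_elts A N)) / real N ^ 3) / a\<^sup>2"
    by (simp add: B_def)
qed

section \<open>Small energy: convergence along a sparse sequence\<close>

lemma pair_corr_mono:
  assumes "s \<le> s'"
  shows "pair_corr \<alpha> \<gamma> s N A \<le> pair_corr \<alpha> \<gamma> s' N A"
  unfolding pair_corr_def
proof (intro mult_left_mono of_nat_mono card_mono)
  show "{(i, j) \<in> {1..N} \<times> {1..N}. i \<noteq> j \<and>
        torus_norm (real (elt A i) * \<alpha> - real (elt A j) * \<alpha> - \<gamma>) \<le> s / real N}
    \<subseteq> {(i, j) \<in> {1..N} \<times> {1..N}. i \<noteq> j \<and>
        torus_norm (real (elt A i) * \<alpha> - real (elt A j) * \<alpha> - \<gamma>) \<le> s' / real N}"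
    using divide_right_mono[OF assms, of "real N"] by auto
  show "finite {(i, j) \<in> {1..N} \<times> {1..N}. i \<noteq> j \<and>
        torus_norm (real (elt A i) * \<alpha> - real (elt A j) * \<alpha> - \<gamma>) \<le> s' / real N}"
    by (rule finite_subset[of _ "{1..N} \<times> {1..N}"]) auto
qed simp

text \<open>Monotonicity squeezes \<open>F s\<close> between nearby rational parameters. This lets a
  single null set serve every \<open>s\<close>.\<close>

lemma tendsto_of_tendsto_rational:
  fixes F :: "real \<Rightarrow> nat \<Rightarrow> real"
  assumes mono: "\<And>q r t. q \<le> r \<Longrightarrow> F q t \<le> F r t"
    and lim: "\<And>q. q \<in> \<rat> \<Longrightarrow> q > 0 \<Longrightarrow> F q \<longlonglongrightarrow> 2 * q"
    and "s > 0"
  shows "F s \<longlonglongrightarrow> 2 * s"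
proof (rule LIMSEQ_I)
  fix r :: real assume "r > 0"
  \<comment> \<open>For parameters within \<open>r / 4\<close> of \<open>s\<close> the limits differ
    from \<open>2 * s\<close> by less than \<open>r / 2\<close>, which leaves \<open>r / 2\<close>
    for the convergence. The maximum with 0 makes \<open>q\<close> positive.\<close>
  obtain q where q: "q \<in> \<rat>" "max 0 (s - r / 4) < q" "q < s"
    using Rats_dense_in_real[of "max 0 (s - r / 4)" s] \<open>s > 0\<close> \<open>r > 0\<close> by auto
  obtain q' where q': "q' \<in> \<rat>" "s < q'" "q' < s + r / 4"
    using Rats_dense_in_real[of s "s + r / 4"] \<open>r > 0\<close> by auto
  have "eventually (\<lambda>t. dist (F q t) (2 * q) < r / 2 \<and> dist (F q' t) (2 * q') < r / 2) sequentially"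
    using q q' \<open>r > 0\<close> \<open>s > 0\<close> by (intro eventually_conj tendstoD lim) auto
  then obtain M where M: "\<And>t. t \<ge> M \<Longrightarrow> dist (F q t) (2 * q) < r / 2 \<and> dist (F q' t) (2 * q') < r / 2"
    by (auto simp: eventually_sequentially)
  have "norm (F s t - 2 * s) < r" if "t \<ge> M" for t
    using M[OF that, THEN conjunct1] M[OF that, THEN conjunct2] mono[of q s t] mono[of s q' t] q q'
    unfolding dist_real_def real_norm_def by linarith
  then show "\<exists>M. \<forall>t\<ge>M. norm (F s t - 2 * s) < r" by blast
qed

lemma strict_mono_choice:
  fixes P :: "nat \<Rightarrow> nat \<Rightarrow> bool"
  assumes "\<And>t m. \<exists>n>m. P t n"
  obtains N where "strict_mono N" "\<And>t. N t > 0" "\<And>t. P t (N t)"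
proof -
  have "\<exists>N. \<forall>t. (P t (N t) \<and> N t > 0) \<and> N t < N (Suc t)"
  proof (rule dependent_nat_choice)
    show "\<exists>n. P 0 n \<and> n > 0" using assms[of 0 0] by blast
    show "\<exists>n. (P (Suc t) n \<and> n > 0) \<and> m < n" for m t using assms[of m "Suc t"] by fastforce
  qed
  then show ?thesis using that by (auto simp: strict_mono_Suc_iff)
qed

text \<open>With deviation threshold \<open>(1 / 2) ^ t\<close>, Chebyshev's inequality turns the
  energy bound \<open>(1 / 8) ^ t\<close> into the summable bound \<open>2 s (1 / 2) ^ t\<close>.
  Borel-Cantelli then applies, and the means \<open>m t\<close> tend to
  \<open>2 * s\<close>.\<close>

lemma AE_pair_corr_tendsto:
  assumes "infinite A" "strict_mono N" "\<And>t. N t > 0"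
    and energy: "\<And>t. real (additive_energy (first_elts A (N t))) / real (N t) ^ 3 < (1 / 8) ^ t"
    and "s > 0"
  shows "AE z in unit_square. (\<lambda>t. pair_corr (fst z) (snd z) s (N t) A) \<longlonglongrightarrow> 2 * s"
proof -
  define m where "m = (\<lambda>t. 2 * s * (1 - 1 / real (N t)))"
  define X where "X = (\<lambda>t z. pair_corr (fst z) (snd z) s (N t) A - m t)"
  \<comment> \<open>A shift by \<open>k\<close> secures \<open>2 * s \<le> N (t + k)\<close>, as a
    strictly increasing sequence satisfies \<open>t \<le> N t\<close>.\<close>
  define k where "k = nat \<lceil>2 * s\<rceil>"
  define bad where "bad = (\<lambda>t. {z \<in> space unit_square. \<bar>X (t + k) z\<bar> \<ge> (1 / 2) ^ (t + k)})"
  have large: "2 * s \<le> real (N (t + k))" for t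
  proof -
    have "2 * s \<le> real k" unfolding k_def by linarith
    moreover have "t + k \<le> N (t + k)" using assms(2) by (rule strict_mono_imp_increasing)
    ultimately show ?thesis by linarith
  qed
  have bad_sets: "bad t \<in> sets unit_square" for t
    unfolding bad_def X_def m_def by (rule prob_pair_corr_deviation_le) (use assms large in auto)
  have bad_prob: "measure unit_square (bad t) \<le> 2 * s * (1 / 2) ^ (t + k)" for t
  proof -
    have "measure unit_square (bad t)
      \<le> 2 * s * (real (additive_energy (first_elts A (N (t + k)))) / real (N (t + k)) ^ 3) / ((1 / 2) ^ (t + k))\<^sup>2"
      unfolding bad_def X_def m_def by (rule prob_pair_corr_deviation_le) (use assms large in auto)
    also have "\<dots> \<le> 2 * s * (1 / 8) ^ (t + k) / ((1 / 2) ^ (t + k))\<^sup>2"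
      using energy[of "t + k"] \<open>s > 0\<close> by (intro divide_right_mono mult_left_mono) auto
    also have "\<dots> = 2 * s * ((1 / 8) / (1 / 2)\<^sup>2) ^ (t + k)"
      by (simp only: power_divide[of "1 / 8" "(1 / 2)\<^sup>2"] power_mult[symmetric]
          mult.commute[of _ "2 :: nat"] times_divide_eq_right)
    also have "\<dots> = 2 * s * (1 / 2) ^ (t + k)"
      by (simp add: power2_eq_square)
    finally show ?thesis .
  qed
  have "summable (\<lambda>t. 2 * s * (1 / 2 :: real) ^ (t + k))"
    by (intro summable_mult summable_ignore_initial_segment summable_geometric) simp
  then have "summable (\<lambda>t. measure unit_square (bad t))"
    by (rule summable_comparison_test'[where N = 0]) (use bad_prob in simp)
  then have ae: "AE z in unit_square. eventually (\<lambda>t. z \<in> space unit_square - bad t) sequentially"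
    using bad_sets by (intro borel_cantelli_AE1) (auto simp: less_top[symmetric])
  have m_lim: "m \<longlonglongrightarrow> 2 * s"
  proof -
    have "(\<lambda>t. 1 / real (N t)) \<longlonglongrightarrow> 0"
      using LIMSEQ_subseq_LIMSEQ[OF lim_1_over_n assms(2)] by (simp add: o_def)
    then have "m \<longlonglongrightarrow> 2 * s * (1 - 0)"
      unfolding m_def by (intro tendsto_intros)
    then show ?thesis by simp
  qed
  show ?thesis
    using ae
  proof eventually_elim
    case (elim z)
    have "(\<lambda>t. X (t + k) z) \<longlonglongrightarrow> 0"
    proof (rule Lim_null_comparison)
      show "eventually (\<lambda>t. norm (X (t + k) z) \<le> (1 / 2) ^ (t + k)) sequentially"
        using elim by eventually_elim (auto simp: bad_def)
      show "(\<lambda>t. (1 / 2 :: real) ^ (t + k)) \<longlonglongrightarrow> 0"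
        by (intro LIMSEQ_ignore_initial_segment LIMSEQ_power_zero) simp
    qed
    then have "(\<lambda>t. X t z) \<longlonglongrightarrow> 0" by (rule LIMSEQ_offset)
    from tendsto_add[OF this m_lim] show ?case by (simp add: X_def)
  qed
qed

lemma poissonian_along_if_energy_small:
  assumes "infinite A" "strict_mono N" "\<And>t. N t > 0"
    and "\<And>t. real (additive_energy (first_elts A (N t))) / real (N t) ^ 3 < (1 / 8) ^ t"
  shows "doubly_metric_poissonian_along A N"
proof -
  \<comment> \<open>The exceptional null set depends on the parameter, so countably many parameters
    are treated first.\<close>
  have "AE z in unit_square. \<forall>q\<in>\<rat> \<inter> {0<..}. (\<lambda>t. pair_corr (fst z) (snd z) q (N t) A) \<longlonglongrightarrow> 2 * q"
    using AE_pair_corr_tendsto[OF assms]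
    by (intro AE_ball_countable') (auto intro: countable_Int1 countable_rat)
  then have "AE z in unit_square. \<forall>s>0. (\<lambda>t. pair_corr (fst z) (snd z) s (N t) A) \<longlonglongrightarrow> 2 * s"
  proof eventually_elim
    case (elim z)
    show ?case
    proof (intro allI impI)
      fix s :: real assume "s > 0"
      show "(\<lambda>t. pair_corr (fst z) (snd z) s (N t) A) \<longlonglongrightarrow> 2 * s"
        by (rule tendsto_of_tendsto_rational[where F = "\<lambda>s t. pair_corr (fst z) (snd z) s (N t) A"])
           (use elim \<open>s > 0\<close> pair_corr_mono in auto)
    qed
  qed
  then show ?thesis by (simp add: doubly_metric_poissonian_along_def case_prod_beta)
qed

section \<open>Large energy: failure along every increasing sequence\<close>

text \<open>
  The differences with at least \<open>c N / 2\<close> representations carry a positive proportion of the energy,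
  so there are between \<open>c N / 4\<close> and \<open>2 N / c\<close> of them. On the union of their strips the pair
  correlation is at least \<open>c / 2\<close>, twice the expected value \<open>2 s = c / 4\<close>.
\<close>

lemma large_energy_event:
  assumes "infinite A" and c: "0 < c" "c \<le> 1" and N: "real N \<ge> 4 / c"
    and E: "real (additive_energy (first_elts A N)) \<ge> c * real N ^ 3"
  obtains U where "U \<in> sets unit_square" "measure unit_square U \<ge> c\<^sup>2 / 32"
    "\<And>z. z \<in> U \<Longrightarrow> pair_corr (fst z) (snd z) (c / 8) N A \<ge> c / 2"
proof -
  define B where "B = first_elts A N"
  define D0 where "D0 = nonzero_diffs B"
  define D where "D = {d \<in> D0. real (diff_count B d) \<ge> c * real N / 2}"
  define \<epsilon> where "\<epsilon> = c / 8 / real N"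
  define p where "p = 2 * \<epsilon>"
  have "4 / c > 0" using c by simp
  with N have N0: "real N > 0" by linarith
  have cN: "c * real N \<ge> 4" using N c by (simp add: field_simps)
  have fin: "finite B" "finite D0" "finite D" by (simp_all add: B_def D0_def D_def)
  have cardB: "card B = N" using assms(1) by (simp add: B_def card_first_elts)
  have sum_D0: "(\<Sum>d\<in>D0. real (diff_count B d)) \<le> real N ^ 2"
  proof -
    have "(\<Sum>d\<in>D0. diff_count B d) \<le> N\<^sup>2"
      using sum_diff_count[OF fin(1)] by (simp add: D0_def cardB)
    then show ?thesis by (metis of_nat_le_iff of_nat_power of_nat_sum)
  qed
  \<comment> \<open>Each difference in \<open>D\<close> takes up at least \<open>c N / 2\<close> of
    the at most \<open>N^2\<close> pairs.\<close>
  have "real (card D) * (c * real N / 2) \<le> (\<Sum>d\<in>D. real (diff_count B d))"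
    by (rule sum_bounded_below) (simp add: D_def)
  also have "\<dots> \<le> (\<Sum>d\<in>D0. real (diff_count B d))"
    using fin by (intro sum_mono2) (auto simp: D_def)
  finally have "real (card D) * (c * real N / 2) \<le> real N * real N"
    using sum_D0 by (simp add: power2_eq_square)
  then have upper: "real (card D) * c \<le> 2 * real N"
    using N0 by (simp add: field_simps)
  have "c * real N ^ 3 \<le> (\<Sum>d\<in>D0. (real (diff_count B d))\<^sup>2) + real N ^ 2"
    using E additive_energy_eq_sum_diff_count[OF fin(1)] by (simp add: B_def[symmetric] D0_def cardB)
  \<comment> \<open>Outside \<open>D\<close> one factor of the square is below
    \<open>c N / 2\<close>, so these differences account for at most half of \<open>c N^3\<close>;
    each one in \<open>D\<close> adds at most \<open>N^2\<close>.\<close>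
  also have "(\<Sum>d\<in>D0. (real (diff_count B d))\<^sup>2) \<le> (\<Sum>d\<in>D0. real (diff_count B d) * (c * real N / 2) + (if d \<in> D then real N ^ 2 else 0))"
  proof (rule sum_mono)
    fix d assume "d \<in> D0"
    have le: "real (diff_count B d) \<le> real N" using diff_count_le[OF fin(1), of d] by (simp add: cardB)
    show "(real (diff_count B d))\<^sup>2 \<le> real (diff_count B d) * (c * real N / 2) + (if d \<in> D then real N ^ 2 else 0)"
    proof (cases "d \<in> D")
      case True
      have "(real (diff_count B d))\<^sup>2 \<le> real N ^ 2" using le by (intro power_mono) auto
      moreover have "0 \<le> real (diff_count B d) * (c * real N / 2)" using c by simp
      ultimately show ?thesis unfolding if_P[OF True] by linarith
    next
      case False
      then have "real (diff_count B d) \<le> c * real N / 2" using \<open>d \<in> D0\<close> by (auto simp: D_def)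
      then have "real (diff_count B d) * real (diff_count B d) \<le> real (diff_count B d) * (c * real N / 2)"
        by (rule mult_left_mono) simp
      then show ?thesis using False by (simp add: power2_eq_square)
    qed
  qed
  also have "\<dots> = (\<Sum>d\<in>D0. real (diff_count B d)) * (c * real N / 2) + real (card D) * real N ^ 2"
  proof -
    have "D0 \<inter> D = D" by (auto simp: D_def)
    then show ?thesis using fin by (simp add: sum.distrib sum_distrib_right sum.If_cases)
  qed
  also have "\<dots> \<le> real N ^ 2 * (c * real N / 2) + real (card D) * real N ^ 2"
    using sum_D0 c by (intro add_mono mult_right_mono) auto
  finally have "real N ^ 2 * (c * real N) \<le> real N ^ 2 * (c * real N / 2 + real (card D) + 1)"
    by (simp add: algebra_simps power2_eq_square power3_eq_cube)
  then have "c * real N \<le> c * real N / 2 + real (card D) + 1"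
    using N0 by (subst (asm) mult_le_cancel_left_pos) auto
  \<comment> \<open>The 1 stems from the difference 0, and \<open>c N / 2 - 1 \<ge> c N / 4\<close>
    because \<open>c N \<ge> 4\<close>.\<close>
  then have lower: "real (card D) \<ge> c * real N / 4" using cN by linarith
  have p: "p = c / (4 * real N)" by (simp add: p_def \<epsilon>_def)
  have \<epsilon>: "0 \<le> \<epsilon>" "\<epsilon> \<le> 1 / 2"
    using c cN N0 by (auto simp: \<epsilon>_def field_simps)
  define U where "U = (\<Union>d\<in>D. strip \<epsilon> d)"
  \<comment> \<open>The expected number of strips containing a point. The bounds on
    \<open>card D\<close> place it between \<open>c^2 / 16\<close> and 1, where
    \<open>x - x^2 / 2 \<ge> x / 2\<close>; hence the constant \<open>c^2 / 32\<close>.\<close>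
  define x where "x = real (card D) * p"
  have x: "x \<ge> c\<^sup>2 / 16" "x \<le> 1" "x \<ge> 0"
    using upper lower c N0 by (auto simp: x_def p field_simps power2_eq_square)
  have "measure unit_square U \<ge> x - x\<^sup>2 / 2"
    unfolding U_def x_def
    by (rule unit_square.prob_UN_pairwise_independent_ge)
       (auto simp: fin p_def prob_strip[OF \<epsilon>] prob_strip_Int[OF \<epsilon>])
  moreover have "x\<^sup>2 \<le> x" using x c by (simp add: power2_eq_square mult_left_le)
  ultimately have "measure unit_square U \<ge> c\<^sup>2 / 32" using x by linarith
  moreover have "U \<in> sets unit_square"
    unfolding U_def using fin by (intro sets.finite_UN) auto
  moreover have "pair_corr (fst z) (snd z) (c / 8) N A \<ge> c / 2" if zU: "z \<in> U" for z
  proof -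
    obtain d where d: "d \<in> D" "z \<in> strip \<epsilon> d" using zU by (auto simp: U_def)
    have z: "fst z \<in> {0..<1}" "snd z \<in> {0..<1}" using d by (auto simp: strip_def)
    \<comment> \<open>A single strip from \<open>D\<close> already contributes \<open>c / 2\<close>,
      and all other terms are nonnegative.\<close>
    have "c / 2 \<le> real (diff_count B d) / real N * indicator (strip \<epsilon> d) z"
      using d N0 by (simp add: D_def field_simps)
    also have "\<dots> \<le> (\<Sum>d\<in>D0. real (diff_count B d) / real N * indicator (strip \<epsilon> d) z)"
      using d fin by (intro member_le_sum) (auto simp: D_def)
    also have "\<dots> = pair_corr (fst z) (snd z) (c / 8) N A"
      using pair_corr_eq_sum_strips[OF assms(1) z, of "c / 8" N] by (simp add: B_def D0_def \<epsilon>_def)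
    finally show ?thesis .
  qed
  ultimately show ?thesis using that by blast
qed

text \<open>On the events from \<open>large_energy_event\<close> the pair correlation is at least
  \<open>c / 2\<close>, whereas its limit for \<open>s = c / 8\<close> would be
  \<open>c / 4\<close>. Almost every point would lie in only finitely many of these events, and
  dominated convergence would send their measures to 0, against the lower bound
  \<open>c^2 / 32\<close>.\<close>

lemma not_poissonian_along_if_energy_large:
  assumes "infinite A" "strict_mono N" "0 < c" "c \<le> 1"
    and E: "eventually (\<lambda>n. real (additive_energy (first_elts A n)) \<ge> c * real n ^ 3) sequentially"
  shows "\<not> doubly_metric_poissonian_along A N"
proof
  assume "doubly_metric_poissonian_along A N"
  then have "AE z in unit_square. \<forall>s>0. (\<lambda>t. pair_corr (fst z) (snd z) s (N t) A) \<longlonglongrightarrow> 2 * s"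
    by (simp add: doubly_metric_poissonian_along_def case_prod_beta)
  then have conv: "AE z in unit_square. (\<lambda>t. pair_corr (fst z) (snd z) (c / 8) (N t) A) \<longlonglongrightarrow> 2 * (c / 8)"
  proof eventually_elim
    case (elim z)
    then show ?case using \<open>0 < c\<close> by (meson divide_pos_pos zero_less_numeral)
  qed
  have "eventually (\<lambda>n. real n \<ge> 4 / c) sequentially"
    using filterlim_real_sequentially by (auto simp: filterlim_at_top)
  with E have "eventually (\<lambda>n. real (additive_energy (first_elts A n)) \<ge> c * real n ^ 3 \<and> real n \<ge> 4 / c) sequentially"
    by eventually_elim simp
  then obtain M where M: "\<And>n. n \<ge> M \<Longrightarrow> real (additive_energy (first_elts A n)) \<ge> c * real n ^ 3 \<and> real n \<ge> 4 / c"
    by (auto simp: eventually_sequentially)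
  \<comment> \<open>The shift by \<open>M\<close> gives \<open>N (t + M) \<ge> M\<close>, the range
    in which the energy bound and \<open>n \<ge> 4 / c\<close> hold.\<close>
  have "\<exists>U. U \<in> sets unit_square \<and> measure unit_square U \<ge> c\<^sup>2 / 32 \<and>
      (\<forall>z\<in>U. pair_corr (fst z) (snd z) (c / 8) (N (t + M)) A \<ge> c / 2)" for t
  proof -
    have "N (t + M) \<ge> M"
      using strict_mono_imp_increasing[OF assms(2), of "t + M"] by linarith
    then show ?thesis
      using large_energy_event[OF assms(1,3,4), of "N (t + M)"] M by metis
  qed
  then obtain U where U: "\<And>t. U t \<in> sets unit_square" "\<And>t. measure unit_square (U t) \<ge> c\<^sup>2 / 32"
      "\<And>t z. z \<in> U t \<Longrightarrow> pair_corr (fst z) (snd z) (c / 8) (N (t + M)) A \<ge> c / 2"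
    by metis
  note U(1)[measurable]
  have "AE z in unit_square. (\<lambda>t. indicator (U t) z :: real) \<longlonglongrightarrow> 0"
    using conv
  proof eventually_elim
    case (elim z)
    have "eventually (\<lambda>t. pair_corr (fst z) (snd z) (c / 8) (N (t + M)) A < c / 2) sequentially"
      using LIMSEQ_ignore_initial_segment[OF elim, of M] \<open>0 < c\<close> by (intro order_tendstoD) auto
    then have "eventually (\<lambda>t. indicator (U t) z = (0 :: real)) sequentially"
    proof eventually_elim
      case (elim t)
      then have "z \<notin> U t" using U(3)[of z t] by auto
      then show ?case by simp
    qed
    then show ?case by (rule tendsto_eventually)
  qed
  then have "(\<lambda>t. \<integral>z. indicator (U t) z \<partial>unit_square) \<longlonglongrightarrow> (\<integral>z. 0 \<partial>unit_square :: real)"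
    by (intro integral_dominated_convergence[where w = "\<lambda>_. 1"]) (auto simp: indicator_def)
  moreover have "(\<integral>z. indicator (U t) z \<partial>unit_square) = measure unit_square (U t)" for t
    using sets.sets_into_space[OF U(1)[of t]] by (simp add: Int_absorb2)
  ultimately have "(\<lambda>t. measure unit_square (U t)) \<longlonglongrightarrow> 0" by simp
  then have "c\<^sup>2 / 32 \<le> 0"
    by (rule LIMSEQ_le_const) (use U(2) in blast)
  then show False using \<open>0 < c\<close> by simp
qed

theorem theorem2p6:
  fixes A :: "nat set"
  assumes "infinite A" and "0 \<notin> A"
  shows "(\<exists>N :: nat \<Rightarrow> nat. strict_mono N \<and> (\<forall>t. N t > 0) \<and> doubly_metric_poissonian_along A N)
     \<longleftrightarrow> liminf (\<lambda>N. ereal (real (additive_energy (first_elts A N)) / real N ^ 3)) = 0"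
    (is "?P \<longleftrightarrow> liminf (\<lambda>N. ereal (?e N)) = 0")
proof
  assume ?P
  then obtain N where N: "strict_mono N" "doubly_metric_poissonian_along A N" by blast
  show "liminf (\<lambda>N. ereal (?e N)) = 0"
  proof (rule ccontr)
    assume "liminf (\<lambda>N. ereal (?e N)) \<noteq> 0"
    moreover have "liminf (\<lambda>N. ereal (?e N)) \<ge> 0" by (rule Liminf_bounded) simp
    ultimately have "0 < liminf (\<lambda>N. ereal (?e N))" by simp
    then obtain b where b': "0 < ereal b" "ereal b < liminf (\<lambda>N. ereal (?e N))"
      using ereal_dense2 by blast
    have b: "b > 0" "eventually (\<lambda>n. ereal b < ereal (?e n)) sequentially"
      using b'(1) less_LiminfD[OF b'(2)] by simp_all
    \<comment> \<open>The minimum with 1 meets the condition \<open>c \<le> 1\<close> of the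
      large-energy case.\<close>
    define c where "c = min b 1"
    have c: "0 < c" "c \<le> 1" "c \<le> b" using b by (auto simp: c_def)
    have "eventually (\<lambda>n. real (additive_energy (first_elts A n)) \<ge> c * real n ^ 3) sequentially"
      using b(2) eventually_gt_at_top[of 0]
    proof eventually_elim
      case (elim n)
      then have "c \<le> ?e n" using c by simp
      then show ?case using elim(2) by (simp add: pos_le_divide_eq)
    qed
    with not_poissonian_along_if_energy_large[OF assms(1) N(1) c(1,2)] N(2) show False by blast
  qed
next
  assume lim: "liminf (\<lambda>N. ereal (?e N)) = 0"
  \<comment> \<open>Otherwise \<open>(1 / 8) ^ t\<close> would bound the lower limit from below. The
    rate 1/8 is the one that the Borel-Cantelli argument uses.\<close>
  have "\<exists>n>m. ?e n < (1 / 8) ^ t" for t m :: nat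
  proof (rule ccontr)
    assume "\<not> (\<exists>n>m. ?e n < (1 / 8) ^ t)"
    then have "ereal ((1 / 8) ^ t) \<le> ereal (?e n)" if "n > m" for n
      using that by (force simp: not_less)
    then have "eventually (\<lambda>n. ereal ((1 / 8) ^ t) \<le> ereal (?e n)) sequentially"
      using eventually_gt_at_top[of m] by (rule eventually_mono[rotated])
    from Liminf_bounded[OF this] have "(1 / 8 :: real) ^ t \<le> 0"
      unfolding lim by (simp add: zero_ereal_def)
    moreover have "(1 / 8 :: real) ^ t > 0" by (rule zero_less_power) simp
    ultimately show False by linarith
  qed
  then obtain N where "strict_mono N" "\<And>t. N t > 0" "\<And>t. ?e (N t) < (1 / 8) ^ t"
    using strict_mono_choice[where P = "\<lambda>t n. ?e n < (1 / 8) ^ t"] by blast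
  then show ?P using poissonian_along_if_energy_small[OF assms(1)] by blast
qed

end
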